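(* Let $M$ be an $m\times n$ partial matrix with nonnegative specified entries subordinate to a pattern $S\subseteq[m]\times[n]$, and let $Z\subseteq S$ be the subset of positions of the zero entries. Let $C$ be the set of vertex covers of $G(Z)$ no vertex of which is incident to an edge of $G(S\setminus Z)$. Then the set of completions of $M$ is $$\bigcup_{c\in C}X(c;M).$$
   Context: $[m]=\{1,\dots,m\}$. A partial matrix subordinate to a pattern $S\subseteq[m]\times[n]$ is an $m\times n$ matrix in which exactly the entries in positions $S$ are specified. $\Delta^{mn-1}$ is the standard simplex of real $m\times n$ matrices with nonnegative entries summing to one. A completion of $M$ is a rank-one matrix in $\Delta^{mn-1}$ agreeing with $M$ on $S$. For $T\subseteq[m]\times[n]$, $G(T)$ is the bipartite graph with vertices all rows $r_1,\dots,r_m$ and all columns $c_1,\dots,c_n$ and an edge $r_ic_j$ for each $(i,j)\in T$. A vertex cover of $G(Z)$ is a set of vertices meeting every edge of $G(Z)$; a set $c$ of vertices is identified with a pair $(I,J)$, $I\subseteq[m]$ being the set of its rows and $J\subseteq[n]$ the set of its columns. For such a pair (where the specified entries in rows of $I$ or columns of $J$ are precisely the zero entries of $M$), $X(c;M)=X(I,J;M)$ is the set of completions of $M$ in which all entries of the rows in $I$ and of the columns in $J$ are zero. *)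

theory Defs
  imports "HOL-Analysis.Analysis"
begin

type_synonym ('m, 'n) partial_matrix = "'m \<times> 'n \<Rightarrow> real option"

definition subordinate_to :: "('m, 'n) partial_matrix \<Rightarrow> ('m \<times> 'n) set \<Rightarrow> bool" where
  "subordinate_to M S \<longleftrightarrow> dom M = S"

definition matrix_simplex :: "(real ^ 'n ^ 'm) set" where
  "matrix_simplex = {A. (\<forall>i j. 0 \<le> A $ i $ j) \<and> (\<Sum>i\<in>UNIV. \<Sum>j\<in>UNIV. A $ i $ j) = 1}"

definition completions :: "('m, 'n) partial_matrix \<Rightarrow> (real ^ 'n ^ 'm) set" where
  "completions M = {A \<in> matrix_simplex. rank A = 1 \<and> (\<forall>(i, j) \<in> dom M. M (i, j) = Some (A $ i $ j))}"

text \<open>A graph is a pair of a vertex set and a set of edges, each edge being the set of its endpoints.\<close>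

type_synonym 'v graph = "'v set \<times> 'v set set"

text \<open>\<open>Inl i\<close> is the row vertex \<open>r\<^sub>i\<close> and \<open>Inr j\<close> the column vertex \<open>c\<^sub>j\<close>.\<close>

definition bip_graph :: "('m \<times> 'n) set \<Rightarrow> ('m + 'n) graph" where
  "bip_graph T = (range Inl \<union> range Inr, {{Inl i, Inr j} | i j. (i, j) \<in> T})"

definition vertex_cover :: "'v graph \<Rightarrow> 'v set \<Rightarrow> bool" where
  "vertex_cover G c \<longleftrightarrow> c \<subseteq> fst G \<and> (\<forall>e \<in> snd G. c \<inter> e \<noteq> {})"

definition incident_to_edge :: "'v graph \<Rightarrow> 'v \<Rightarrow> bool" where
  "incident_to_edge G v \<longleftrightarrow> (\<exists>e \<in> snd G. v \<in> e)"

text \<open>The set \<open>X(I, J; M)\<close>. It is intended for pairs such that the specified entries of \<open>M\<close> in the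
  rows of \<open>I\<close> or the columns of \<open>J\<close> are precisely the zero entries of \<open>M\<close>; the definition is
  total and does not record this condition.\<close>

definition X_set :: "'m set \<Rightarrow> 'n set \<Rightarrow> ('m, 'n) partial_matrix \<Rightarrow> (real ^ 'n ^ 'm) set" where
  "X_set I J M = {A \<in> completions M. \<forall>i j. i \<in> I \<or> j \<in> J \<longrightarrow> A $ i $ j = 0}"

definition X_cover :: "('m + 'n) set \<Rightarrow> ('m, 'n) partial_matrix \<Rightarrow> (real ^ 'n ^ 'm) set" where
  "X_cover c M = X_set {i. Inl i \<in> c} {j. Inr j \<in> c} M"

end

theory Submission
  imports Defs
begin

text \<open>Only one inclusion has content, since every \<open>X_cover c M\<close> consists of completions of \<open>M\<close>.
  All rows of a rank-one matrix are multiples of any nonzero row, so a zero entry of such a matrix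
  forces its whole row or its whole column to vanish (\<open>rank_one_zero_entry\<close>). Given a completion
  \<open>A\<close>, let \<open>c\<close> consist of the zero rows and zero columns of \<open>A\<close>. Each specified zero then lies in a
  row or column belonging to \<open>c\<close>, so \<open>c\<close> is a vertex cover of \<open>G(Z)\<close>; a row or column containing a
  specified nonzero entry is not a zero row or column of \<open>A\<close>, so no vertex of \<open>c\<close> meets an edge of
  \<open>G(S - Z)\<close>. By construction \<open>A\<close> belongs to the set \<open>X_cover c M\<close> of this \<open>c\<close>.\<close>

text \<open>A one-dimensional row space is spanned by any nonzero vector in it.\<close>

lemma rank_one_row_multiple:
  fixes A :: "real ^ 'n ^ 'm"
  assumes "rank A = 1" and "A $ i \<noteq> 0"
  obtains t where "A $ k = t *\<^sub>R A $ i"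
proof -
  have mem: "A $ l \<in> rows A" for l
    by (auto simp: rows_def row_def)
  have "dim (rows A) = 1"
    using assms(1) by (simp add: row_rank_def)
  moreover have "dim {A $ i} = 1"
    using assms(2) by (simp add: dim_eq_card_independent)
  ultimately have "span {A $ i} = span (rows A)"
    using mem by (intro dim_eq_span) auto
  then have "A $ k \<in> span {A $ i}"
    using mem by (simp add: span_base)
  then show thesis
    using that by (auto simp: span_singleton)
qed

lemma rank_one_zero_entry:
  fixes A :: "real ^ 'n ^ 'm"
  assumes "rank A = 1" and "A $ i $ j = 0"
  shows "(\<forall>l. A $ i $ l = 0) \<or> (\<forall>k. A $ k $ j = 0)"
proof (cases "A $ i = 0")
  case False
  have "A $ k $ j = 0" for k
    using rank_one_row_multiple[OF assms(1) False, of k] assms(2)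
    by (metis mult_zero_right real_scaleR_def vector_scaleR_component)
  then show ?thesis by blast
qed simp

theorem proposition3p7:
  fixes M :: "('m::finite, 'n::finite) partial_matrix"
    and S Z :: "('m \<times> 'n) set"
    and C :: "('m + 'n) set set"
  assumes "subordinate_to M S"
    and "\<forall>p \<in> S. 0 \<le> the (M p)"
    and "Z = {p \<in> S. the (M p) = 0}"
    and "C = {c. vertex_cover (bip_graph Z) c \<and>
                 (\<forall>v \<in> c. \<not> incident_to_edge (bip_graph (S - Z)) v)}"
  shows "completions M = (\<Union>c \<in> C. X_cover c M)"
proof
  show "(\<Union>c \<in> C. X_cover c M) \<subseteq> completions M"
    by (auto simp: X_cover_def X_set_def)
next
  show "completions M \<subseteq> (\<Union>c \<in> C. X_cover c M)"
  proof
    fix A assume A: "A \<in> completions M"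
    then have rk: "rank A = 1"
      by (simp add: completions_def)
    have entry: "the (M (i, j)) = A $ i $ j" if "(i, j) \<in> S" for i j
    proof -
      have "(i, j) \<in> dom M"
        using that assms(1) by (simp add: subordinate_to_def)
      then have "M (i, j) = Some (A $ i $ j)"
        using A unfolding completions_def by blast
      then show ?thesis by simp
    qed
    define c where "c = Inl ` {i. \<forall>j. A $ i $ j = 0} \<union> Inr ` {j. \<forall>i. A $ i $ j = 0}"
    have "vertex_cover (bip_graph Z) c"
    proof -
      have "c \<inter> {Inl i, Inr j} \<noteq> {}" if "(i, j) \<in> Z" for i j
      proof -
        have "A $ i $ j = 0"
          using that entry assms(3) by auto
        from rank_one_zero_entry[OF rk this] show ?thesis
          by (auto simp: c_def)
      qed
      moreover have "c \<subseteq> fst (bip_graph Z)"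
        by (auto simp: c_def bip_graph_def)
      moreover have "\<exists>i j. (i, j) \<in> Z \<and> e = {Inl i, Inr j}" if "e \<in> snd (bip_graph Z)" for e
        using that by (auto simp: bip_graph_def)
      ultimately show ?thesis
        unfolding vertex_cover_def by metis
    qed
    moreover have "\<not> incident_to_edge (bip_graph (S - Z)) v" if "v \<in> c" for v
    proof
      assume "incident_to_edge (bip_graph (S - Z)) v"
      then obtain i j where ij: "(i, j) \<in> S - Z" and v: "v = Inl i \<or> v = Inr j"
        by (auto simp: incident_to_edge_def bip_graph_def)
      have "A $ i $ j \<noteq> 0"
        using ij entry assms(3) by auto
      then show False
        using v that by (auto simp: c_def)
    qed
    ultimately have "c \<in> C"
      using assms(4) by blast
    moreover have "A \<in> X_cover c M"
      using A by (auto simp: X_cover_def X_set_def c_def)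
    ultimately show "A \<in> (\<Union>c \<in> C. X_cover c M)"
      by blast
  qed
qed

end
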